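(* Let $f\in\mathcal F_{m,L}$ with minimizer $x^\star$, let $A\in\mathbb R^{n\times n}$, $B\in\mathbb R^{n\times d}$, $C,E\in\mathbb R^{d\times n}$ ($d\le n$), and consider the iteration, for $k=0,1,2,\dots$, $$\xi_{k+1}=A\xi_k+Bu_k,\qquad u_k=\nabla f(y_k),\qquad y_k=C\xi_k,\qquad x_k=E\xi_k,$$ with fixed point $\xi^\star\in\mathbb R^n$ satisfying $A\xi^\star=\xi^\star$, $C\xi^\star=E\xi^\star=x^\star$. Suppose that there exist $a_0>0$, $\rho\in(0,1)$, $\ell>0$ and a symmetric matrix $P\in\mathbb R^{n\times n}$ with $\widetilde P:=P+\frac{a_0m}{2}E^{T}E\succ0$ such that $$T=M^{(0)}+a_0\rho^2M^{(1)}+a_0(1-\rho^2)M^{(2)}+\ell M^{(3)}\preceq 0,$$ where $$M^{(0)}=\begin{bmatrix}A^{T}PA-\rho^2P&A^{T}PB\\ B^{T}PA&B^{T}PB\end{bmatrix},\qquad M^{(1)}=N^{(1)}+N^{(2)},\quad M^{(2)}=N^{(1)}+N^{(3)},\quad M^{(3)}=N^{(4)},$$ with $$N^{(1)}=\begin{bmatrix}EA-C&EB\\0&I_d\end{bmatrix}^{T}\begin{bmatrix}\frac L2I_d&\frac12I_d\\ \frac12I_d&0\end{bmatrix}\begin{bmatrix}EA-C&EB\\0&I_d\end{bmatrix},$$ $$N^{(2)}=\begin{bmatrix}C-E&0\\0&I_d\end{bmatrix}^{T}\begin{bmatrix}-\frac m2I_d&\frac12I_d\\ \frac12I_d&0\end{bmatrix}\begin{bmatrix}C-E&0\\0&I_d\end{bmatrix},$$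 $$N^{(3)}=\begin{bmatrix}C^{T}&0\\0&I_d\end{bmatrix}\begin{bmatrix}-\frac m2I_d&\frac12I_d\\ \frac12I_d&0\end{bmatrix}\begin{bmatrix}C&0\\0&I_d\end{bmatrix},$$ $$N^{(4)}=\begin{bmatrix}C^{T}&0\\0&I_d\end{bmatrix}\begin{bmatrix}-\frac{mL}{m+L}I_d&\frac12I_d\\ \frac12I_d&-\frac1{m+L}I_d\end{bmatrix}\begin{bmatrix}C&0\\0&I_d\end{bmatrix}.$$ Then the sequence $\{x_k\}$ satisfies, for all $k\ge0$, $$\|x_k-x^\star\|^2\le\lambda_{\max}(E^{T}E)\,\|\xi_k-\xi^\star\|^2\le\frac{\lambda_{\max}(E^{T}E)}{\lambda_{\min}(\widetilde P)}\,V_0(\xi_0)\,\rho^{2k},$$ where, with $x=E\xi$, $$V_k(\xi)=\rho^{-2k}\Big(a_0\big(f(x)-f(x^\star)\big)+(\xi-\xi^\star)^{T}P(\xi-\xi^\star)\Big).$$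
   Context: For $0<m\le L$, $\mathcal F_{m,L}$ denotes the set of differentiable functions $f:\mathbb R^d\to\mathbb R$ that are $m$-strongly convex and have $L$-Lipschitz gradient. $I_d$ is the $d\times d$ identity. $\|\cdot\|$ is the Euclidean norm. $\lambda_{\max}(\cdot)$, $\lambda_{\min}(\cdot)$ denote the largest and smallest eigenvalue of a symmetric matrix. $X\succ0$ (resp. $X\preceq 0$) means that the symmetric matrix $X$ is positive definite (resp. negative semidefinite). $P$ is not required to be positive semidefinite. *)

theory Defs
  imports "HOL-Analysis.Analysis"
begin

(* The gradient is the representing vector of the Frechet derivative; it is unspecified at points
   where f is not differentiable. *)
definition gradient :: "('a::real_inner \<Rightarrow> real) \<Rightarrow> 'a \<Rightarrow> 'a" where
  "gradient f x = (THE g. GDERIV f x :> g)"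

definition strongly_convex :: "real \<Rightarrow> ('a::real_inner \<Rightarrow> real) \<Rightarrow> bool" where
  "strongly_convex m f \<longleftrightarrow>
     (\<forall>x y. \<forall>t\<in>{0..1}.
        f ((1 - t) *\<^sub>R x + t *\<^sub>R y)
          \<le> (1 - t) * f x + t * f y - m / 2 * t * (1 - t) * (norm (x - y))\<^sup>2)"

definition scvx_smooth :: "real \<Rightarrow> real \<Rightarrow> ('a::real_inner \<Rightarrow> real) set" where
  "scvx_smooth m L =
     {f. (\<forall>x. f differentiable (at x)) \<and> strongly_convex m f \<and> L-lipschitz_on UNIV (gradient f)}"

definition sym_mat :: "real^'n^'n \<Rightarrow> bool" where
  "sym_mat X \<longleftrightarrow> transpose X = X"

definition pos_def :: "real^'n^'n \<Rightarrow> bool" where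
  "pos_def X \<longleftrightarrow> sym_mat X \<and> (\<forall>v. v \<noteq> 0 \<longrightarrow> v \<bullet> (X *v v) > 0)"

definition neg_semidef :: "real^'n^'n \<Rightarrow> bool" where
  "neg_semidef X \<longleftrightarrow> sym_mat X \<and> (\<forall>v. v \<bullet> (X *v v) \<le> 0)"

definition eigenvalues :: "real^'n^'n \<Rightarrow> real set" where
  "eigenvalues X = {c. \<exists>v. v \<noteq> 0 \<and> X *v v = c *\<^sub>R v}"

(* Only used for symmetric X, whose set of (real) eigenvalues is finite and nonempty. *)
definition lambda_max :: "real^'n^'n \<Rightarrow> real" where
  "lambda_max X = Max (eigenvalues X)"

definition lambda_min :: "real^'n^'n \<Rightarrow> real" where
  "lambda_min X = Min (eigenvalues X)"

(* The 2x2 block matrix with rows [W X] and [Y Z]; the sum type concatenates the index sets. *)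
definition block :: "real^'a^'r \<Rightarrow> real^'b^'r \<Rightarrow> real^'a^'s \<Rightarrow> real^'b^'s
    \<Rightarrow> real^('a + 'b)^('r + 's)" where
  "block W X Y Z = (\<chi> i j.
     case i of
       Inl r \<Rightarrow> (case j of Inl a \<Rightarrow> W $ r $ a | Inr b \<Rightarrow> X $ r $ b)
     | Inr s \<Rightarrow> (case j of Inl a \<Rightarrow> Y $ s $ a | Inr b \<Rightarrow> Z $ s $ b))"

(* Here mat c is the scalar matrix c I. *)

definition N1 :: "real \<Rightarrow> real^'n^'n \<Rightarrow> real^'d^'n \<Rightarrow> real^'n^'d \<Rightarrow> real^'n^'d
    \<Rightarrow> real^('n + 'd)^('n + 'd)" where
  "N1 L A B C E =
     transpose (block (E ** A - C) (E ** B) 0 (mat 1 :: real^'d^'d))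
     ** block (mat (L / 2) :: real^'d^'d) (mat (1 / 2) :: real^'d^'d) (mat (1 / 2) :: real^'d^'d) 0
     ** block (E ** A - C) (E ** B) 0 (mat 1 :: real^'d^'d)"

definition N2 :: "real \<Rightarrow> real^'n^'d \<Rightarrow> real^'n^'d \<Rightarrow> real^('n + 'd)^('n + 'd)" where
  "N2 m C E =
     transpose (block (C - E) 0 0 (mat 1 :: real^'d^'d))
     ** block (mat (- m / 2) :: real^'d^'d) (mat (1 / 2) :: real^'d^'d) (mat (1 / 2) :: real^'d^'d) 0
     ** block (C - E) 0 0 (mat 1 :: real^'d^'d)"

definition N3 :: "real \<Rightarrow> real^'n^'d \<Rightarrow> real^('n + 'd)^('n + 'd)" where
  "N3 m C =
     block (transpose C) 0 0 (mat 1 :: real^'d^'d)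
     ** block (mat (- m / 2) :: real^'d^'d) (mat (1 / 2) :: real^'d^'d) (mat (1 / 2) :: real^'d^'d) 0
     ** block C 0 0 (mat 1 :: real^'d^'d)"

definition N4 :: "real \<Rightarrow> real \<Rightarrow> real^'n^'d \<Rightarrow> real^('n + 'd)^('n + 'd)" where
  "N4 m L C =
     block (transpose C) 0 0 (mat 1 :: real^'d^'d)
     ** block (mat (- (m * L / (m + L))) :: real^'d^'d) (mat (1 / 2) :: real^'d^'d)
              (mat (1 / 2) :: real^'d^'d) (mat (- (1 / (m + L))) :: real^'d^'d)
     ** block C 0 0 (mat 1 :: real^'d^'d)"

definition M0 :: "real \<Rightarrow> real^'n^'n \<Rightarrow> real^'n^'n \<Rightarrow> real^'d^'n
    \<Rightarrow> real^('n + 'd)^('n + 'd)" where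
  "M0 \<rho> P A B =
     block (transpose A ** P ** A - \<rho>\<^sup>2 *\<^sub>R P) (transpose A ** P ** B)
           (transpose B ** P ** A) (transpose B ** P ** B)"

definition M1 :: "real \<Rightarrow> real \<Rightarrow> real^'n^'n \<Rightarrow> real^'d^'n \<Rightarrow> real^'n^'d \<Rightarrow> real^'n^'d
    \<Rightarrow> real^('n + 'd)^('n + 'd)" where
  "M1 m L A B C E = N1 L A B C E + N2 m C E"

definition M2 :: "real \<Rightarrow> real \<Rightarrow> real^'n^'n \<Rightarrow> real^'d^'n \<Rightarrow> real^'n^'d \<Rightarrow> real^'n^'d
    \<Rightarrow> real^('n + 'd)^('n + 'd)" where
  "M2 m L A B C E = N1 L A B C E + N3 m C"

definition M3 :: "real \<Rightarrow> real \<Rightarrow> real^'n^'d \<Rightarrow> real^('n + 'd)^('n + 'd)" where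
  "M3 m L C = N4 m L C"

definition T_mat :: "real \<Rightarrow> real \<Rightarrow> real \<Rightarrow> real \<Rightarrow> real \<Rightarrow> real^'n^'n
    \<Rightarrow> real^'n^'n \<Rightarrow> real^'d^'n \<Rightarrow> real^'n^'d \<Rightarrow> real^'n^'d \<Rightarrow> real^('n + 'd)^('n + 'd)" where
  "T_mat m L a0 \<rho> l P A B C E =
     M0 \<rho> P A B + (a0 * \<rho>\<^sup>2) *\<^sub>R M1 m L A B C E + (a0 * (1 - \<rho>\<^sup>2)) *\<^sub>R M2 m L A B C E
     + l *\<^sub>R M3 m L C"

definition P_tilde :: "real \<Rightarrow> real \<Rightarrow> real^'n^'n \<Rightarrow> real^'n^'d \<Rightarrow> real^'n^'n" where
  "P_tilde m a0 P E = P + (a0 * m / 2) *\<^sub>R (transpose E ** E)"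

definition V :: "(real^'d \<Rightarrow> real) \<Rightarrow> real^'d \<Rightarrow> real^'n \<Rightarrow> real \<Rightarrow> real \<Rightarrow> real^'n^'n \<Rightarrow> real^'n^'d
    \<Rightarrow> nat \<Rightarrow> real^'n \<Rightarrow> real" where
  "V f xstar \<xi>star a0 \<rho> P E k \<xi> =
     \<rho> powi (- 2 * int k)
       * (a0 * (f (E *v \<xi>) - f xstar) + (\<xi> - \<xi>star) \<bullet> (P *v (\<xi> - \<xi>star)))"

end

theory Submission
  imports Defs
begin

text \<open>The matrix inequality says that a Lyapunov function contracts. Write \<open>e\<close> for the error
  \<open>\<xi> - \<xi>\<^sup>*\<close> of the state and put \<open>W = a0 (f x - f x\<^sup>*) + e \<bullet> P e\<close>, so that \<open>V\<close> is
  \<open>W\<close> divided by \<open>\<rho>\<^sup>2\<^sup>k\<close>. Evaluated at the stacked vector of the error \<open>e\<close> and the gradient \<open>u\<close>, the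
  blocks of \<open>T\<close> become quantities with a meaning for \<open>f\<close>: the form of \<open>M0\<close> is the next
  value of \<open>e \<bullet> P e\<close> minus \<open>\<rho>\<^sup>2\<close> times the current one; the forms of \<open>N1\<close>, \<open>N2\<close>, \<open>N3\<close> bound from above the differences of
  \<open>f\<close> between the next output and \<open>y\<close>, between \<open>y\<close> and the current output, and between \<open>y\<close>
  and the minimizer (the first by the Lipschitz gradient, lemma
  \<open>lipschitz_gradient_upper_bound\<close>, the others by strong convexity, lemma
  \<open>strongly_convex_first_order\<close>); the form of \<open>N4\<close> is nonnegative by lemma
  \<open>strongly_convex_smooth_coercive\<close>. Since
  \<open>f x\<^sup>+ - f x\<^sup>* - \<rho>\<^sup>2 (f x - f x\<^sup>*) = \<rho>\<^sup>2 (f x\<^sup>+ - f x) + (1 - \<rho>\<^sup>2) (f x\<^sup>+ - f x\<^sup>*)\<close>,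
  the weights in \<open>T\<close> are exactly those for which \<open>T \<preceq> 0\<close> yields \<open>W\<^sup>+ \<le> \<rho>\<^sup>2 W\<close>.

  The matrix \<open>P\<close> may be indefinite, but strong convexity gives
  \<open>f x - f x\<^sup>* \<ge> m/2 \<parallel>E e\<parallel>\<^sup>2\<close>, and this pays for the summand that turns \<open>P\<close> into \<open>P_tilde\<close>: thus
  \<open>W \<ge> e \<bullet> P_tilde e \<ge> \<lambda>\<^sub>m\<^sub>i\<^sub>n \<parallel>e\<parallel>\<^sup>2\<close>. The two estimates bound \<open>\<parallel>e\<parallel>\<close>, and the largest eigenvalue of
  \<open>E\<^sup>T E\<close> transfers the bound to the outputs. Both eigenvalue estimates rest on lemma
  \<open>ex_eigenvalue_rayleigh_lower_bound\<close>: a symmetric matrix has an eigenvalue that bounds its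
  quadratic form from below.\<close>

section \<open>Smooth strongly convex functions\<close>

text \<open>The Riesz representative of the derivative, assembled from its values on the basis, is the
  unique witness of the description that defines \<^const>\<open>gradient\<close>.\<close>

lemma GDERIV_gradient:
  fixes f :: "'a::euclidean_space \<Rightarrow> real"
  assumes "f differentiable (at x)"
  shows "GDERIV f x :> gradient f x"
proof -
  obtain D where D: "(f has_derivative D) (at x)"
    using assms by (auto simp: differentiable_def)
  then have lin: "linear D" by (rule has_derivative_linear)
  define g where "g = (\<Sum>b\<in>Basis. D b *\<^sub>R b)"
  have "D h = h \<bullet> g" for h
  proof -
    have "D h = D (\<Sum>b\<in>Basis. (h \<bullet> b) *\<^sub>R b)" by (simp add: euclidean_representation)
    also have "\<dots> = (\<Sum>b\<in>Basis. (h \<bullet> b) * D b)"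
      using lin by (simp add: linear_sum linear_scale)
    also have "\<dots> = h \<bullet> g"
      unfolding g_def by (simp add: inner_sum_right mult.commute)
    finally show ?thesis .
  qed
  then have "D = (\<lambda>h. h \<bullet> g)" by (rule ext)
  with D have g: "GDERIV f x :> g" by (simp add: gderiv_def)
  moreover have "g' = g" if "GDERIV f x :> g'" for g'
  proof -
    have "(\<lambda>h. h \<bullet> g') = (\<lambda>h. h \<bullet> g)"
      using that g unfolding gderiv_def by (rule has_derivative_unique)
    then have "(g' - g) \<bullet> g' = (g' - g) \<bullet> g" by meson
    then have "(g' - g) \<bullet> (g' - g) = 0" by (simp add: inner_diff_right)
    then show ?thesis by simp
  qed
  ultimately show ?thesis
    unfolding gradient_def by (rule theI)
qed

lemma DERIV_along_line:
  fixes f :: "'a::euclidean_space \<Rightarrow> real"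
  assumes "\<And>z. f differentiable (at z)"
  shows "((\<lambda>t. f (x + t *\<^sub>R d)) has_real_derivative gradient f (x + t *\<^sub>R d) \<bullet> d) (at t)"
proof -
  have "(f has_derivative (\<lambda>h. h \<bullet> gradient f (x + t *\<^sub>R d))) (at (x + t *\<^sub>R d))"
    using GDERIV_gradient[OF assms] unfolding gderiv_def .
  moreover have "((\<lambda>t. x + t *\<^sub>R d) has_derivative (\<lambda>s. s *\<^sub>R d)) (at t)"
    by (auto intro!: derivative_eq_intros)
  ultimately have "((\<lambda>t. f (x + t *\<^sub>R d)) has_derivative
      (\<lambda>s. (s *\<^sub>R d) \<bullet> gradient f (x + t *\<^sub>R d))) (at t)"
    using has_derivative_compose by blast
  then show ?thesis
    unfolding has_field_derivative_def
    by (rule has_derivative_eq_rhs) (simp add: fun_eq_iff inner_commute)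
qed

text \<open>Strong convexity bounds the difference quotient of \<open>f\<close> at \<open>x\<close> in the direction \<open>y - x\<close> by
  \<open>f y - f x - m/2 (1 - t) \<parallel>y - x\<parallel>\<^sup>2\<close>; let \<open>t\<close> tend to \<open>0\<close> from the right.\<close>

lemma strongly_convex_first_order:
  fixes f :: "'a::euclidean_space \<Rightarrow> real"
  assumes diff: "\<And>z. f differentiable (at z)" and sc: "strongly_convex m f"
  shows "f x + gradient f x \<bullet> (y - x) + m / 2 * (norm (y - x))\<^sup>2 \<le> f y"
proof -
  define d where "d = y - x"
  have "((\<lambda>t. f (x + t *\<^sub>R d)) has_real_derivative gradient f x \<bullet> d) (at 0)"
    using DERIV_along_line[OF diff, where x = x and d = d and t = 0] by simp
  then have lim: "((\<lambda>t. (f (x + t *\<^sub>R d) - f x) / t) \<longlongrightarrow> gradient f x \<bullet> d) (at_right 0)"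
    by (auto simp: has_field_derivative_iff intro: filterlim_mono at_le)
  have bound: "(f (x + t *\<^sub>R d) - f x) / t \<le> f y - f x - m / 2 * (1 - t) * (norm d)\<^sup>2"
    if "0 < t" "t < 1" for t
  proof -
    have "f (x + t *\<^sub>R d) \<le> (1 - t) * f x + t * f y - m / 2 * t * (1 - t) * (norm d)\<^sup>2"
      using sc[unfolded strongly_convex_def, rule_format, of t x y] that
      by (simp add: d_def algebra_simps norm_minus_commute)
    also have "\<dots> = f x + (f y - f x - m / 2 * (1 - t) * (norm d)\<^sup>2) * t"
      by (simp add: algebra_simps)
    finally show ?thesis using that by (simp add: pos_divide_le_eq)
  qed
  have "((\<lambda>t. f y - f x - m / 2 * (1 - t) * (norm d)\<^sup>2)
      \<longlongrightarrow> f y - f x - m / 2 * (1 - 0) * (norm d)\<^sup>2) (at_right 0)"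
    by (intro tendsto_intros)
  moreover have "\<forall>\<^sub>F t in at_right 0.
      (f (x + t *\<^sub>R d) - f x) / t \<le> f y - f x - m / 2 * (1 - t) * (norm d)\<^sup>2"
    using eventually_at_right_real[of 0 "1::real"]
    by (rule eventually_mono[OF _ bound]) auto
  ultimately have "gradient f x \<bullet> d \<le> f y - f x - m / 2 * (1 - 0) * (norm d)\<^sup>2"
    using lim by (intro tendsto_le[OF trivial_limit_at_right_real])
  then show ?thesis by (simp add: d_def)
qed

text \<open>Along the segment from \<open>x\<close> to \<open>y\<close>, the gap between \<open>f\<close> and the quadratic bound has
  derivative \<open>(\<nabla>f (x + t d) - \<nabla>f x) \<bullet> d - L t \<parallel>d\<parallel>\<^sup>2\<close>, which the Lipschitz condition makes
  nonpositive by Cauchy--Schwarz.\<close>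

lemma lipschitz_gradient_upper_bound:
  fixes f :: "'a::euclidean_space \<Rightarrow> real"
  assumes diff: "\<And>z. f differentiable (at z)" and lip: "L-lipschitz_on UNIV (gradient f)"
  shows "f y \<le> f x + gradient f x \<bullet> (y - x) + L / 2 * (norm (y - x))\<^sup>2"
proof -
  define d where "d = y - x"
  define \<phi> where "\<phi> t = f (x + t *\<^sub>R d) - t * (gradient f x \<bullet> d) - L / 2 * t\<^sup>2 * (norm d)\<^sup>2" for t
  have "\<phi> 1 \<le> \<phi> 0"
  proof (rule DERIV_nonpos_imp_nonincreasing[of 0 1 \<phi>])
    fix t :: real
    assume t: "0 \<le> t" "t \<le> 1"
    let ?D = "gradient f (x + t *\<^sub>R d) \<bullet> d - gradient f x \<bullet> d - L * t * (norm d)\<^sup>2"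
    have "(\<phi> has_real_derivative ?D) (at t)"
      unfolding \<phi>_def by (auto intro!: derivative_eq_intros DERIV_along_line diff)
    moreover have "?D \<le> 0"
    proof -
      have "gradient f (x + t *\<^sub>R d) \<bullet> d - gradient f x \<bullet> d
          \<le> norm (gradient f (x + t *\<^sub>R d) - gradient f x) * norm d"
        by (metis inner_diff_left norm_cauchy_schwarz)
      also have "\<dots> \<le> (L * norm (t *\<^sub>R d)) * norm d"
        using lipschitz_onD[OF lip, of "x + t *\<^sub>R d" x]
        by (intro mult_right_mono) (auto simp: dist_norm)
      also have "\<dots> = L * t * (norm d)\<^sup>2"
        using t by (simp add: power2_eq_square)
      finally show ?thesis by simp
    qed
    ultimately show "\<exists>D. (\<phi> has_real_derivative D) (at t) \<and> D \<le> 0" by blast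
  qed simp
  then show ?thesis by (simp add: \<phi>_def d_def)
qed

text \<open>A gradient step of length \<open>1/L\<close> from a minimizer would decrease \<open>f\<close> by at least
  \<open>\<parallel>\<nabla>f\<parallel>\<^sup>2 / (2 L)\<close>.\<close>

lemma gradient_minimizer_eq_0:
  fixes f :: "'a::euclidean_space \<Rightarrow> real"
  assumes "\<And>z. f differentiable (at z)" and "L-lipschitz_on UNIV (gradient f)" and "0 < L"
    and min: "\<And>z. f xs \<le> f z"
  shows "gradient f xs = 0"
proof -
  let ?g = "gradient f xs"
  have "f xs \<le> f (xs - (1 / L) *\<^sub>R ?g)" by (rule min)
  also have "\<dots> \<le> f xs + ?g \<bullet> (- (1 / L) *\<^sub>R ?g) + L / 2 * (norm (- (1 / L) *\<^sub>R ?g))\<^sup>2"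
    using lipschitz_gradient_upper_bound[OF assms(1,2), of "xs - (1 / L) *\<^sub>R ?g" xs] by simp
  also have "\<dots> = f xs - (norm ?g)\<^sup>2 / (2 * L)"
    using \<open>0 < L\<close> by (simp add: power_mult_distrib power_divide dot_square_norm field_simps power2_eq_square)
  finally have "(norm ?g)\<^sup>2 \<le> 0"
    using \<open>0 < L\<close> by (simp add: zero_le_divide_iff divide_le_0_iff)
  then show ?thesis by simp
qed

text \<open>Compare the lower quadratic bound of \<open>f\<close> based at one of the points \<open>x\<close>, \<open>y\<close> with the upper
  quadratic bound based at the other, at the test points \<open>y - s\<close> and \<open>x + s\<close>. Adding the two
  comparisons cancels the function values and leaves, for every \<open>s\<close>, an inequality that is
  quadratic in \<open>s\<close>; the best \<open>s\<close> is the multiple \<open>1/(L - m)\<close> of \<open>G - m d\<close>. When \<open>L = m\<close> the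
  quadratic term disappears, so that arbitrarily large multiples force \<open>G = m d\<close>.\<close>

lemma strongly_convex_smooth_coercive:
  fixes f :: "'a::euclidean_space \<Rightarrow> real"
  assumes f: "f \<in> scvx_smooth m L" and mL: "m \<le> L"
  shows "m * L * (norm (y - x))\<^sup>2 + (norm (gradient f y - gradient f x))\<^sup>2
    \<le> (m + L) * ((gradient f y - gradient f x) \<bullet> (y - x))"
proof -
  define d where "d = y - x"
  define G where "G = gradient f y - gradient f x"
  define w where "w = G - m *\<^sub>R d"
  have diff: "\<And>z. f differentiable (at z)" and sc: "strongly_convex m f"
    and lip: "L-lipschitz_on UNIV (gradient f)"
    using f by (auto simp: scvx_smooth_def)
  note lower = strongly_convex_first_order[OF diff sc]
  note upper = lipschitz_gradient_upper_bound[OF diff lip]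
  \<comment> \<open>Any single \<open>s\<close> gives a lower bound for the same number, so \<open>s\<close> can be chosen afterwards.\<close>
  have test: "2 * (w \<bullet> s) - (L - m) * (s \<bullet> s) \<le> G \<bullet> d - m * (d \<bullet> d)" for s
  proof -
    have "f x + gradient f x \<bullet> (d - s) + m / 2 * ((d - s) \<bullet> (d - s))
        \<le> f y - gradient f y \<bullet> s + L / 2 * (s \<bullet> s)"
      using lower[of x "y - s"] upper[of "y - s" y]
      by (simp add: d_def dot_square_norm algebra_simps)
    moreover have "f y + gradient f y \<bullet> (s - d) + m / 2 * ((s - d) \<bullet> (s - d))
        \<le> f x + gradient f x \<bullet> s + L / 2 * (s \<bullet> s)"
      using lower[of y "x + s"] upper[of "x + s" x]
      by (simp add: d_def dot_square_norm algebra_simps)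
    ultimately show ?thesis
      by (simp add: w_def G_def inner_diff_left inner_diff_right inner_commute algebra_simps)
  qed
  have "w \<bullet> w \<le> (L - m) * (G \<bullet> d - m * (d \<bullet> d))"
  proof (cases "L = m")
    case True
    have "w = 0"
    proof (rule ccontr)
      assume "w \<noteq> 0"
      then show False
        using test[of "((G \<bullet> d - m * (d \<bullet> d) + 1) / (2 * (w \<bullet> w))) *\<^sub>R w"] True by simp
    qed
    then show ?thesis using True by simp
  next
    case False
    with mL have "0 < L - m" by simp
    have "2 * (w \<bullet> w / (L - m)) - w \<bullet> w / (L - m) \<le> G \<bullet> d - m * (d \<bullet> d)"
      using test[of "(1 / (L - m)) *\<^sub>R w"] \<open>0 < L - m\<close> by simp
    then show ?thesis
      using \<open>0 < L - m\<close> by (simp add: pos_divide_le_eq mult.commute)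
  qed
  then have "m * L * (d \<bullet> d) + G \<bullet> G \<le> (m + L) * (G \<bullet> d)"
    by (simp add: w_def inner_diff_left inner_diff_right inner_commute algebra_simps)
  then show ?thesis by (simp add: d_def G_def dot_square_norm)
qed

section \<open>Extreme eigenvalues of symmetric matrices\<close>

lemma sym_mat_inner_swap:
  assumes "sym_mat X"
  shows "v \<bullet> (X *v w) = (X *v v) \<bullet> w"
  using assms by (metis dot_lmul_matrix sym_mat_def transpose_matrix_vector)

text \<open>Eigenvectors for different eigenvalues are orthogonal, hence linearly independent.\<close>

lemma finite_eigenvalues:
  fixes X :: "real^'n^'n"
  assumes "sym_mat X"
  shows "finite (eigenvalues X)"
proof -
  have "\<forall>c\<in>eigenvalues X. \<exists>v. v \<noteq> 0 \<and> X *v v = c *\<^sub>R v"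
    by (simp add: eigenvalues_def)
  then obtain F where F: "\<And>c. c \<in> eigenvalues X \<Longrightarrow> F c \<noteq> 0 \<and> X *v F c = c *\<^sub>R F c"
    by metis
  have orth: "F b \<bullet> F c = 0" if "b \<in> eigenvalues X" "c \<in> eigenvalues X" "b \<noteq> c" for b c
  proof -
    have "c * (F b \<bullet> F c) = F b \<bullet> (X *v F c)" using F[OF that(2)] by simp
    also have "\<dots> = (X *v F b) \<bullet> F c" using assms by (rule sym_mat_inner_swap)
    also have "\<dots> = b * (F b \<bullet> F c)" using F[OF that(1)] by simp
    finally show ?thesis using that(3) by simp
  qed
  have "pairwise orthogonal (F ` eigenvalues X)"
    unfolding pairwise_def orthogonal_def using orth by blast
  moreover have "0 \<notin> F ` eigenvalues X"
    using F by (metis imageE)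
  ultimately have "independent (F ` eigenvalues X)"
    by (rule pairwise_orthogonal_independent)
  then have "finite (F ` eigenvalues X)" by (rule independent_imp_finite)
  moreover have "inj_on F (eigenvalues X)"
    by (rule inj_onI) (metis F inner_eq_zero_iff orth)
  ultimately show ?thesis by (rule finite_imageD)
qed

text \<open>The least value \<open>c\<close> of the quadratic form on the unit sphere is an eigenvalue: the form
  \<open>Q v = v \<bullet> X v - c \<parallel>v\<parallel>\<^sup>2\<close> is nonnegative and vanishes at a minimizer \<open>v0\<close>, so its gradient
  \<open>2 (X v0 - c v0)\<close> vanishes there as well.\<close>

lemma ex_eigenvalue_rayleigh_lower_bound:
  fixes X :: "real^'n^'n"
  assumes X: "sym_mat X"
  shows "\<exists>c\<in>eigenvalues X. \<forall>v. c * (norm v)\<^sup>2 \<le> v \<bullet> (X *v v)"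
proof -
  have "continuous_on (sphere 0 1) (\<lambda>v. v \<bullet> (X *v v))"
    by (intro continuous_intros)
  moreover have "sphere (0::real^'n) 1 \<noteq> {}" by simp
  ultimately have "\<exists>v0\<in>sphere 0 1. \<forall>v\<in>sphere 0 1. v0 \<bullet> (X *v v0) \<le> v \<bullet> (X *v v)"
    by (intro continuous_attains_inf compact_sphere)
  then obtain v0 where v0: "norm v0 = 1"
    and min: "\<And>v. norm v = 1 \<Longrightarrow> v0 \<bullet> (X *v v0) \<le> v \<bullet> (X *v v)"
    by auto
  define c where "c = v0 \<bullet> (X *v v0)"
  have lower: "c * (norm v)\<^sup>2 \<le> v \<bullet> (X *v v)" for v
  proof (cases "v = 0")
    case False
    have "c \<le> ((1 / norm v) *\<^sub>R v) \<bullet> (X *v ((1 / norm v) *\<^sub>R v))"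
      unfolding c_def using False by (intro min) simp
    also have "\<dots> = (v \<bullet> (X *v v)) / (norm v)\<^sup>2"
      by (simp add: matrix_vector_mult_scaleR power2_eq_square)
    finally show ?thesis using False by (simp add: pos_le_divide_eq)
  qed simp
  define Q where "Q v = v \<bullet> (X *v v) - c * (v \<bullet> v)" for v
  have Q_nonneg: "0 \<le> Q v" for v
    using lower[of v] by (simp add: Q_def dot_square_norm)
  define w where "w = X *v v0 - c *\<^sub>R v0"
  have "w = 0"
  proof (rule ccontr)
    assume "w \<noteq> 0"
    then have w: "0 < w \<bullet> w" by simp
    \<comment> \<open>Moving from \<open>v0\<close> by \<open>- t w\<close> changes \<open>Q\<close> by \<open>t\<^sup>2 Q w - 2 t \<parallel>w\<parallel>\<^sup>2\<close>, negative for small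
      \<open>t\<close>; the summand \<open>1\<close> keeps the denominator positive when \<open>Q w = 0\<close>.\<close>
    define t where "t = (w \<bullet> w) / (Q w + 1)"
    have t: "0 < t" using w Q_nonneg[of w] by (simp add: t_def)
    have "v0 \<bullet> v0 = 1" using v0 by (simp add: dot_square_norm)
    then have "Q (v0 - t *\<^sub>R w) = t * (t * Q w - 2 * (w \<bullet> w))"
      using sym_mat_inner_swap[OF X, of v0 w]
      by (simp add: Q_def w_def[symmetric] c_def[symmetric] matrix_vector_mult_diff_distrib
          matrix_vector_mult_scaleR inner_diff_left inner_diff_right algebra_simps)
        (simp add: w_def inner_diff_left inner_diff_right inner_commute algebra_simps)
    with Q_nonneg[of "v0 - t *\<^sub>R w"] t have "2 * (w \<bullet> w) \<le> t * Q w"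
      by (simp add: zero_le_mult_iff)
    also have "\<dots> \<le> t * (Q w + 1)" using t by simp
    also have "\<dots> = w \<bullet> w" using Q_nonneg[of w] by (simp add: t_def)
    finally show False using w by simp
  qed
  then have "c \<in> eigenvalues X"
    using v0 by (auto simp: eigenvalues_def w_def intro!: exI[of _ v0])
  with lower show ?thesis by blast
qed

lemma lambda_min_rayleigh:
  assumes "sym_mat X"
  shows "lambda_min X * (norm v)\<^sup>2 \<le> v \<bullet> (X *v v)"
proof -
  obtain c where "c \<in> eigenvalues X" "c * (norm v)\<^sup>2 \<le> v \<bullet> (X *v v)"
    using ex_eigenvalue_rayleigh_lower_bound[OF assms] by blast
  moreover have "lambda_min X \<le> c"
    unfolding lambda_min_def using finite_eigenvalues[OF assms] calculation(1) by (rule Min_le)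
  ultimately show ?thesis
    by (meson mult_right_mono order_trans zero_le_power2)
qed

text \<open>Negating the matrix negates its eigenvalues and its quadratic form.\<close>

lemma lambda_max_rayleigh:
  assumes X: "sym_mat X"
  shows "v \<bullet> (X *v v) \<le> lambda_max X * (norm v)\<^sup>2"
proof -
  have neg: "(- X) *v z = - (X *v z)" for z
    by (simp add: vec_eq_iff matrix_vector_mult_def sum_negf)
  have "sym_mat (- X)"
    using X by (simp add: sym_mat_def transpose_def vec_eq_iff)
  then obtain c where c: "c \<in> eigenvalues (- X)" "c * (norm v)\<^sup>2 \<le> v \<bullet> ((- X) *v v)"
    using ex_eigenvalue_rayleigh_lower_bound by blast
  then have "- c \<in> eigenvalues X"
    by (auto simp: eigenvalues_def neg minus_equation_iff[of "X *v _"])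
  with finite_eigenvalues[OF X] have "- c \<le> lambda_max X"
    unfolding lambda_max_def by (rule Max_ge)
  then have "- c * (norm v)\<^sup>2 \<le> lambda_max X * (norm v)\<^sup>2"
    by (rule mult_right_mono) simp
  with c(2) show ?thesis by (simp add: neg)
qed

lemma lambda_min_pos:
  assumes "pos_def X"
  shows "0 < lambda_min X"
proof -
  have X: "sym_mat X" and pos: "\<And>v. v \<noteq> 0 \<Longrightarrow> 0 < v \<bullet> (X *v v)"
    using assms by (auto simp: pos_def_def)
  have "eigenvalues X \<noteq> {}"
    using ex_eigenvalue_rayleigh_lower_bound[OF X] by blast
  with finite_eigenvalues[OF X] have "lambda_min X \<in> eigenvalues X"
    unfolding lambda_min_def by (rule Min_in)
  then obtain v where v: "v \<noteq> 0" "X *v v = lambda_min X *\<^sub>R v"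
    by (auto simp: eigenvalues_def)
  then have "0 < lambda_min X * (v \<bullet> v)" using pos[of v] by simp
  moreover have "0 < v \<bullet> v" using v(1) by simp
  ultimately show ?thesis by (rule zero_less_mult_pos2)
qed

lemma inner_vector_matrix_mult:
  fixes S :: "real^'a^'b"
  shows "v \<bullet> (w v* S) = (S *v v) \<bullet> w"
  by (metis dot_lmul_matrix inner_commute)

lemma quad_form_gram:
  fixes E :: "real^'n^'d"
  shows "v \<bullet> ((transpose E ** E) *v v) = (norm (E *v v))\<^sup>2"
  by (simp add: inner_vector_matrix_mult dot_square_norm flip: matrix_vector_mul_assoc)

lemma sym_mat_gram: "sym_mat (transpose E ** E)"
  by (simp add: sym_mat_def matrix_transpose_mul)

lemma norm_matrix_vector_le_lambda_max:
  fixes E :: "real^'n^'d"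
  shows "(norm (E *v v))\<^sup>2 \<le> lambda_max (transpose E ** E) * (norm v)\<^sup>2"
  using lambda_max_rayleigh[OF sym_mat_gram] by (simp add: quad_form_gram)

lemma lambda_max_gram_nonneg:
  fixes E :: "real^'n^'d"
  shows "0 \<le> lambda_max (transpose E ** E)"
proof -
  have "0 \<le> (norm (E *v axis undefined 1))\<^sup>2" by simp
  also have "\<dots> \<le> lambda_max (transpose E ** E) * (norm (axis undefined 1 :: real^'n))\<^sup>2"
    by (rule norm_matrix_vector_le_lambda_max)
  finally show ?thesis by (simp add: norm_axis_1)
qed

section \<open>Quadratic forms of block matrices\<close>

definition join :: "real^'a \<Rightarrow> real^'b \<Rightarrow> real^('a + 'b)" where
  "join v w = (\<chi> i. case i of Inl a \<Rightarrow> v $ a | Inr b \<Rightarrow> w $ b)"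

lemma sum_UNIV_Plus:
  fixes h :: "'a::finite + 'b::finite \<Rightarrow> real"
  shows "(\<Sum>i\<in>UNIV. h i) = (\<Sum>a\<in>UNIV. h (Inl a)) + (\<Sum>b\<in>UNIV. h (Inr b))"
  by (simp add: sum.Plus flip: UNIV_Plus_UNIV)

lemma inner_join: "join a b \<bullet> join c d = a \<bullet> c + b \<bullet> d"
  by (simp add: inner_vec_def sum_UNIV_Plus join_def)

lemma block_mult_join:
  "block W X Y Z *v join a b = join (W *v a + X *v b) (Y *v a + Z *v b)"
  by (auto simp: vec_eq_iff matrix_vector_mult_def sum_UNIV_Plus join_def block_def split: sum.split)

lemma transpose_block:
  "transpose (block W X Y Z) = block (transpose W) (transpose Y) (transpose X) (transpose Z)"
  by (auto simp: vec_eq_iff transpose_def block_def split: sum.split)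

lemma transpose_zero: "transpose 0 = (0 :: real^'a^'b)"
  by (simp add: vec_eq_iff transpose_def)

lemma mat_mult_vector: "(mat c :: real^'a^'a) *v v = c *\<^sub>R v"
  by (simp add: vec_eq_iff matrix_vector_mult_def mat_def if_distrib if_distribR cong: if_cong)

lemma quad_form_congruence:
  fixes S :: "real^'a^'b"
  shows "v \<bullet> ((transpose S ** K ** S) *v v) = (S *v v) \<bullet> (K *v (S *v v))"
  by (simp add: inner_vector_matrix_mult flip: matrix_vector_mul_assoc)

text \<open>In the next five lemmas \<open>e\<close> is the state error and \<open>g\<close> the gradient at \<open>y\<close>. The vectors that
  appear are then differences of iterates: \<open>(E A - C) e + E B g\<close> is the next output minus \<open>y\<close>,
  \<open>(C - E) e\<close> is \<open>y\<close> minus the current output, \<open>C e\<close> is \<open>y\<close> minus the minimizer, and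
  \<open>A e + B g\<close> is the next state error.\<close>

lemma N1_quad_form:
  "join e g \<bullet> (N1 L A B C E *v join e g)
   = L / 2 * (norm ((E ** A - C) *v e + (E ** B) *v g))\<^sup>2 + g \<bullet> ((E ** A - C) *v e + (E ** B) *v g)"
  unfolding N1_def quad_form_congruence
  by (simp add: block_mult_join inner_join mat_mult_vector inner_add_right inner_diff_right
      inner_commute add_divide_distrib
      flip: dot_square_norm)

lemma N2_quad_form:
  "join e g \<bullet> (N2 m C E *v join e g)
   = g \<bullet> ((C - E) *v e) - m / 2 * (norm ((C - E) *v e))\<^sup>2"
  unfolding N2_def quad_form_congruence
  by (simp add: block_mult_join inner_join mat_mult_vector inner_add_right inner_diff_right
      inner_commute add_divide_distrib
      flip: dot_square_norm)

lemma block_diag_transpose: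
  "block (transpose C) 0 0 (mat 1) = transpose (block C 0 0 (mat 1))"
  by (simp add: transpose_block transpose_zero transpose_mat)

lemma N3_quad_form:
  "join e g \<bullet> (N3 m C *v join e g) = g \<bullet> (C *v e) - m / 2 * (norm (C *v e))\<^sup>2"
  unfolding N3_def block_diag_transpose quad_form_congruence
  by (simp add: block_mult_join inner_join mat_mult_vector inner_add_right inner_diff_right
      inner_commute add_divide_distrib
      flip: dot_square_norm)

lemma N4_quad_form:
  "join e g \<bullet> (N4 m L C *v join e g)
   = g \<bullet> (C *v e) - m * L / (m + L) * (norm (C *v e))\<^sup>2 - 1 / (m + L) * (norm g)\<^sup>2"
  unfolding N4_def block_diag_transpose quad_form_congruence
  by (simp add: block_mult_join inner_join mat_mult_vector inner_add_right inner_diff_right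
      inner_commute add_divide_distrib
      flip: dot_square_norm)

lemma M0_quad_form:
  "join e g \<bullet> (M0 \<rho> P A B *v join e g)
   = (A *v e + B *v g) \<bullet> (P *v (A *v e + B *v g)) - \<rho>\<^sup>2 * (e \<bullet> (P *v e))"
  unfolding M0_def
  by (simp add: block_mult_join inner_join matrix_vector_mult_diff_rdistrib
      scaleR_matrix_vector_assoc[symmetric] matrix_vector_right_distrib
      inner_add_left inner_add_right inner_diff_right inner_vector_matrix_mult
      flip: matrix_vector_mul_assoc)

section \<open>Decay of the Lyapunov function\<close>

theorem theorem2p3:
  fixes f :: "real^'d \<Rightarrow> real"
    and m L a0 \<rho> l :: real
    and A P :: "real^'n^'n"
    and B :: "real^'d^'n"
    and C E :: "real^'n^'d"
    and \<xi> :: "nat \<Rightarrow> real^'n"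
    and u y x :: "nat \<Rightarrow> real^'d"
    and \<xi>star :: "real^'n"
    and xstar :: "real^'d"
  assumes "0 < m" and "m \<le> L"
    and "CARD('d) \<le> CARD('n)"
    and "f \<in> scvx_smooth m L"
    and "\<And>z. f xstar \<le> f z"
    and "\<And>k. \<xi> (Suc k) = A *v \<xi> k + B *v u k"
    and "\<And>k. u k = gradient f (y k)"
    and "\<And>k. y k = C *v \<xi> k"
    and "\<And>k. x k = E *v \<xi> k"
    and "A *v \<xi>star = \<xi>star"
    and "C *v \<xi>star = xstar"
    and "E *v \<xi>star = xstar"
    and "a0 > 0" and "0 < \<rho>" and "\<rho> < 1" and "l > 0"
    and "sym_mat P"
    and "pos_def (P_tilde m a0 P E)"
    and "neg_semidef (T_mat m L a0 \<rho> l P A B C E)"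
  shows "\<forall>k. (norm (x k - xstar))\<^sup>2
               \<le> lambda_max (transpose E ** E) * (norm (\<xi> k - \<xi>star))\<^sup>2
           \<and> lambda_max (transpose E ** E) * (norm (\<xi> k - \<xi>star))\<^sup>2
               \<le> lambda_max (transpose E ** E) / lambda_min (P_tilde m a0 P E)
                  * V f xstar \<xi>star a0 \<rho> P E 0 (\<xi> 0) * \<rho> ^ (2 * k)"
proof -
  have diff: "\<And>z. f differentiable (at z)" and sc: "strongly_convex m f"
    and lip: "L-lipschitz_on UNIV (gradient f)"
    using assms(4) by (auto simp: scvx_smooth_def)
  note lower = strongly_convex_first_order[OF diff sc]
  note upper = lipschitz_gradient_upper_bound[OF diff lip]
  have "0 < L" using assms(1,2) by simp
  have grad_star: "gradient f xstar = 0"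
    using gradient_minimizer_eq_0[OF diff lip \<open>0 < L\<close> assms(5)] .
  define e where "e k = \<xi> k - \<xi>star" for k
  define W where "W k = a0 * (f (x k) - f xstar) + e k \<bullet> (P *v e k)" for k

  have e_Suc: "e (Suc k) = A *v e k + B *v u k" for k
    using assms(6)[of k] assms(10) by (simp add: e_def matrix_vector_mult_diff_distrib)
  have y_err: "y k - xstar = C *v e k" and x_err: "x k - xstar = E *v e k" for k
    using assms(8,9,11,12) by (simp_all add: e_def matrix_vector_mult_diff_distrib)
  have y_x: "y k - x k = (C - E) *v e k" for k
    using y_err[of k] x_err[of k] by (simp add: matrix_vector_mult_diff_rdistrib algebra_simps)
  have x_Suc_y: "x (Suc k) - y k = (E ** A - C) *v e k + (E ** B) *v u k" for k
    using y_err[of k] x_err[of "Suc k"]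
    by (simp add: e_Suc matrix_vector_mult_diff_rdistrib matrix_vector_right_distrib
        algebra_simps flip: matrix_vector_mul_assoc)

  have step: "W (Suc k) \<le> \<rho>\<^sup>2 * W k" for k
  proof -
    define v where "v = join (e k) (u k)"
    let ?q = "\<lambda>X. v \<bullet> (X *v v)"
    have N1: "f (x (Suc k)) - f (y k) \<le> ?q (N1 L A B C E)"
      using upper[of "x (Suc k)" "y k"]
      by (simp add: v_def N1_quad_form flip: x_Suc_y assms(7))
    have N2: "f (y k) - f (x k) \<le> ?q (N2 m C E)"
      using lower[of "y k" "x k"]
      by (simp add: v_def N2_quad_form norm_minus_commute inner_diff_right flip: y_x assms(7))
    have N3: "f (y k) - f xstar \<le> ?q (N3 m C)"
      using lower[of "y k" xstar]
      by (simp add: v_def N3_quad_form norm_minus_commute inner_diff_right flip: y_err assms(7))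
    have N4: "0 \<le> ?q (N4 m L C)"
    proof -
      have "(m * L * (norm (C *v e k))\<^sup>2 + (norm (u k))\<^sup>2) / (m + L) \<le> u k \<bullet> (C *v e k)"
        using strongly_convex_smooth_coercive[OF assms(4,2), of "y k" xstar] \<open>0 < m\<close> \<open>0 < L\<close>
        by (simp add: grad_star pos_divide_le_eq mult.commute flip: y_err assms(7))
      then show ?thesis by (simp add: v_def N4_quad_form add_divide_distrib)
    qed
    \<comment> \<open>The multipliers of \<open>M1\<close> and \<open>M2\<close> are nonnegative, so the forms may be replaced by the
      function differences that they dominate.\<close>
    have "?q (T_mat m L a0 \<rho> l P A B C E) \<le> 0"
      using assms(19) by (simp add: neg_semidef_def)
    then have "?q (M0 \<rho> P A B) + a0 * \<rho>\<^sup>2 * (?q (N1 L A B C E) + ?q (N2 m C E))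
        + a0 * (1 - \<rho>\<^sup>2) * (?q (N1 L A B C E) + ?q (N3 m C)) + l * ?q (N4 m L C) \<le> 0"
      by (simp add: T_mat_def M1_def M2_def M3_def matrix_vector_mult_add_rdistrib
          scaleR_matrix_vector_assoc[symmetric] inner_add_right)
    moreover have "a0 * \<rho>\<^sup>2 * (f (x (Suc k)) - f (x k))
        \<le> a0 * \<rho>\<^sup>2 * (?q (N1 L A B C E) + ?q (N2 m C E))"
      using N1 N2 assms(13) by (intro mult_left_mono) auto
    moreover have "a0 * (1 - \<rho>\<^sup>2) * (f (x (Suc k)) - f xstar)
        \<le> a0 * (1 - \<rho>\<^sup>2) * (?q (N1 L A B C E) + ?q (N3 m C))"
      using N1 N3 assms(13-15) by (intro mult_left_mono) (auto simp: power_le_one)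
    moreover have "0 \<le> l * ?q (N4 m L C)"
      using N4 assms(16) by simp
    moreover have "?q (M0 \<rho> P A B) = e (Suc k) \<bullet> (P *v e (Suc k)) - \<rho>\<^sup>2 * (e k \<bullet> (P *v e k))"
      by (simp add: v_def M0_quad_form e_Suc)
    ultimately show ?thesis
      by (simp add: W_def algebra_simps)
  qed
  have decay: "W k \<le> W 0 * \<rho> ^ (2 * k)" for k
  proof (induction k)
    case (Suc k)
    have "W (Suc k) \<le> \<rho>\<^sup>2 * W k" by (rule step)
    also have "\<dots> \<le> \<rho>\<^sup>2 * (W 0 * \<rho> ^ (2 * k))" using Suc by (rule mult_left_mono) simp
    finally show ?case by (simp add: power2_eq_square algebra_simps)
  qed simp

  have coercive: "lambda_min (P_tilde m a0 P E) * (norm (e k))\<^sup>2 \<le> W k" for k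
  proof -
    have "lambda_min (P_tilde m a0 P E) * (norm (e k))\<^sup>2 \<le> e k \<bullet> (P_tilde m a0 P E *v e k)"
      using assms(18) by (intro lambda_min_rayleigh) (simp add: pos_def_def)
    also have "\<dots> = e k \<bullet> (P *v e k) + a0 * (m / 2 * (norm (x k - xstar))\<^sup>2)"
      by (simp add: P_tilde_def matrix_vector_mult_add_rdistrib inner_add_right
          scaleR_matrix_vector_assoc[symmetric] quad_form_gram x_err)
    \<comment> \<open>The gradient vanishes at the minimizer, which leaves only the quadratic term of the
      lower bound based there.\<close>
    also have "\<dots> \<le> W k"
      using lower[of xstar "x k"] assms(13) by (simp add: W_def grad_star)
    finally show ?thesis .
  qed

  have "0 < lambda_min (P_tilde m a0 P E)" by (rule lambda_min_pos[OF assms(18)])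
  then have bound: "(norm (e k))\<^sup>2 \<le> W 0 * \<rho> ^ (2 * k) / lambda_min (P_tilde m a0 P E)" for k
    using order_trans[OF coercive decay, of k] by (simp add: pos_le_divide_eq mult.commute)
  have V0: "V f xstar \<xi>star a0 \<rho> P E 0 (\<xi> 0) = W 0"
    by (simp add: V_def W_def e_def assms(9))
  show ?thesis
  proof (intro allI conjI)
    fix k
    show "(norm (x k - xstar))\<^sup>2 \<le> lambda_max (transpose E ** E) * (norm (\<xi> k - \<xi>star))\<^sup>2"
      using norm_matrix_vector_le_lambda_max[of E "e k"] by (simp add: x_err) (simp add: e_def)
    show "lambda_max (transpose E ** E) * (norm (\<xi> k - \<xi>star))\<^sup>2
        \<le> lambda_max (transpose E ** E) / lambda_min (P_tilde m a0 P E)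
           * V f xstar \<xi>star a0 \<rho> P E 0 (\<xi> 0) * \<rho> ^ (2 * k)"
      using mult_left_mono[OF bound[of k] lambda_max_gram_nonneg[of E]] by (simp add: V0 e_def)
  qed
qed

end
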